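(* Let $q=p^k$ be a power of a prime $p$ and let $c,d\in\mathbb{F}_{q^2}$. Then the number $M$ of zeros of $x^q+cx+d$ in $\mathbb{F}_{q^2}$ is given by $$M=\begin{cases}1, & \text{if } c\notin\mu_{q+1},\\ q, & \text{if } c\in\mu_{q+1}\text{ and } d=cd^q,\\ 0, & \text{if } c\in\mu_{q+1}\text{ and } d\neq cd^q.\end{cases}$$
   Context: $\mathbb{F}_{q^2}$ is the finite field with $q^2$ elements and $\mu_{q+1}=\{x\in\mathbb{F}_{q^2}^*: x^{q+1}=1\}$. Zeros are counted as distinct elements of $\mathbb{F}_{q^2}$. *)

theory Defs
  imports
    "HOL-Library.Cardinality"
    "HOL-Computational_Algebra.Primes"
begin

definition mu :: "nat \<Rightarrow> 'a::field set" where
  "mu n = {x. x \<noteq> 0 \<and> x ^ n = 1}"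

end

theory Submission
  imports
    Defs
    "HOL-Computational_Algebra.Polynomial"
    "HOL-Number_Theory.Residues"
begin

text \<open>
  On a field with \<open>q\<^sup>2\<close> elements the map \<open>x \<mapsto> x\<^sup>q\<close> is an additive involution. Applying it to
  \<open>x\<^sup>q = - (c x + d)\<close> and substituting the equation back into the result eliminates \<open>x\<^sup>q\<close>,
  leaving the linear consequence \<open>(1 - c\<^bsup>q+1\<^esup>) x = c\<^sup>q d - d\<^sup>q\<close> of lemma \<open>zero_imp_linear\<close>.

  If \<open>c\<^bsup>q+1\<^esup> \<noteq> 1\<close>, this determines \<open>x\<close>. Hence \<open>x \<mapsto> - (x\<^sup>q + c x)\<close> is injective, and
  therefore bijective because the field is finite: every \<open>d\<close> has exactly one preimage.

  If \<open>c\<^bsup>q+1\<^esup> = 1\<close>, the left side vanishes, so a zero can exist only when \<open>c\<^sup>q d = d\<^sup>q\<close>, which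
  after multiplication by \<open>c\<close> reads \<open>d = c d\<^sup>q\<close>. That such \<open>d\<close> yield the full number \<open>q\<close> of
  zeros is a counting argument. The fibres of \<open>x \<mapsto> - (x\<^sup>q + c x)\<close> partition the \<open>q\<^sup>2\<close> field
  elements. There are at most \<open>q\<close> nonempty fibres, since they lie over roots of \<open>c y\<^sup>q - y\<close>, and
  each has at most \<open>q\<close> elements, being the root set of a polynomial of degree \<open>q\<close>. As the sizes
  add up to \<open>q \<cdot> q\<close>, no fibre over a root of \<open>c y\<^sup>q - y\<close> can have fewer than \<open>q\<close> elements.
\<close>

text \<open>
  Multiplication by a nonzero \<open>x\<close> permutes the nonzero elements, so their product \<open>P\<close> satisfies
  \<open>x\<^bsup>CARD('a) - 1\<^esup> P = P\<close>.
\<close>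
lemma power_CARD_eq_self:
  fixes x :: "'a::{field,finite}"
  shows "x ^ CARD('a) = x"
proof (cases "x = 0")
  case True
  then show ?thesis by simp
next
  case False
  let ?U = "UNIV - {0 :: 'a}"
  have "bij_betw ((*) x) ?U ?U"
    by (rule bij_betw_byWitness[where f' = "\<lambda>y. y / x"]) (use False in auto)
  then have "(\<Prod>y\<in>?U. x * y) = \<Prod>?U"
    by (rule prod.reindex_bij_betw)
  then have "x ^ (CARD('a) - 1) * \<Prod>?U = \<Prod>?U"
    by (simp add: prod.distrib)
  then have "x ^ (CARD('a) - 1) = 1"
    by simp
  then have "x ^ Suc (CARD('a) - 1) = x"
    by (simp only: power_Suc mult_1_right)
  moreover have "Suc (CARD('a) - 1) = CARD('a)"
    using finite_UNIV_card_ge_0[where 'a = 'a] by simp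
  ultimately show ?thesis
    by metis
qed

lemma CHAR_eq_of_CARD_prime_power:
  assumes "prime p" and "CARD('a::{field,finite}) = p ^ n"
  shows "CHAR('a) = p"
proof -
  have "prime CHAR('a)"
    by (intro prime_CHAR_semidom finite_imp_CHAR_pos) simp
  moreover have "CHAR('a) dvd p ^ n"
    using CHAR_dvd_CARD[where 'a = 'a] assms(2) by simp
  ultimately show ?thesis
    using assms(1) prime_dvd_power primes_dvd_imp_eq by blast
qed

text \<open>
  All that the argument uses about the prime power \<open>q\<close>: the first assumption makes
  \<open>x \<mapsto> x\<^sup>q\<close> an involution (lemma \<open>power_power\<close>), the second makes it additive.
\<close>
locale additive_involutive_power =
  fixes q :: nat and t :: "'a::{field,finite} itself"
  assumes CARD_eq: "CARD('a) = q\<^sup>2"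
    and add_power: "(x + y :: 'a) ^ q = x ^ q + y ^ q"
begin

lemma q_ge_2: "q \<ge> 2"
proof -
  have "card {0, 1 :: 'a} \<le> CARD('a)"
    by (rule card_mono) auto
  then have "1 < q\<^sup>2"
    by (simp add: CARD_eq)
  then show ?thesis
    by (cases "q \<le> 1") (auto simp: le_Suc_eq)
qed

lemma power_power [simp]: "((x :: 'a) ^ q) ^ q = x"
  using power_CARD_eq_self[of x] by (simp add: CARD_eq power2_eq_square power_mult)

lemma minus_power: "(- x :: 'a) ^ q = - (x ^ q)"
proof -
  have "x ^ q + (- x) ^ q = 0"
    using add_power[of x "- x"] q_ge_2 by (simp add: zero_power)
  then show ?thesis
    by (simp add: add_eq_0_iff)
qed

lemma zero_imp_linear:
  fixes c d x :: 'a
  assumes "x ^ q + c * x + d = 0"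
  shows "(1 - c ^ (q + 1)) * x = c ^ q * d - d ^ q"
proof -
  have xq: "x ^ q = - (c * x + d)"
    using assms by (simp only: add.assoc eq_neg_iff_add_eq_0)
  have "x = (x ^ q) ^ q"
    by simp
  also have "\<dots> = (- (c * x + d)) ^ q"
    unfolding xq ..
  also have "\<dots> = - (c ^ q * x ^ q + d ^ q)"
    by (simp only: minus_power add_power power_mult_distrib)
  also have "\<dots> = c ^ (q + 1) * x + c ^ q * d - d ^ q"
    unfolding xq by (simp add: algebra_simps)
  finally show ?thesis
    by (simp add: algebra_simps)
qed

lemma card_zeros_eq_1:
  fixes c d :: 'a
  assumes "c ^ (q + 1) \<noteq> 1"
  shows "card {x. x ^ q + c * x + d = 0} = 1"
proof -
  define L where "L = (\<lambda>x. - (x ^ q + c * x))"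
  have zero_iff: "x ^ q + c * x + e = 0 \<longleftrightarrow> L x = e" for x e
    unfolding L_def by (rule neg_eq_iff_add_eq_0[symmetric])
  have "inj L"
  proof
    fix x y assume "L x = L y"
    then have "x ^ q + c * x + L y = 0" "y ^ q + c * y + L y = 0"
      by (simp_all add: zero_iff)
    then have "(1 - c ^ (q + 1)) * x = (1 - c ^ (q + 1)) * y"
      using zero_imp_linear by metis
    then show "x = y"
      using assms by simp
  qed
  moreover from this have "surj L"
    by (simp add: finite_UNIV_inj_surj)
  then obtain x where "L x = d"
    by (metis surjD)
  ultimately have "{x. L x = d} = {x}"
    by (auto dest: injD)
  then show ?thesis
    by (simp add: zero_iff)
qed

lemma zero_imp_eq_mult_power:
  fixes c d x :: 'a
  assumes "c ^ (q + 1) = 1" and "x ^ q + c * x + d = 0"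
  shows "d = c * d ^ q"
proof -
  have "d ^ q = c ^ q * d"
    using zero_imp_linear[OF assms(2)] assms(1) by (simp del: power_Suc)
  then have "c * d ^ q = c ^ (q + 1) * d"
    by (simp add: mult.assoc)
  then show ?thesis
    by (simp only: assms(1) mult_1_left)
qed

text \<open>Since \<open>q \<ge> 2\<close>, the linear part does not affect the degree.\<close>
lemma card_roots_le:
  fixes a b c :: 'a
  assumes "a \<noteq> 0"
  shows "card {x. a * x ^ q + b * x + c = 0} \<le> q"
proof -
  define f where "f = Polynomial.monom a q + [:c, b:]"
  have "degree [:c, b:] < degree (Polynomial.monom a q)"
    using assms q_ge_2 by (simp add: degree_monom_eq)
  then have "degree f = q"
    unfolding f_def using assms by (simp add: degree_add_eq_left degree_monom_eq)
  moreover from this have "f \<noteq> 0"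
    using q_ge_2 by auto
  moreover have "{x. a * x ^ q + b * x + c = 0} = {x. poly f x = 0}"
    by (simp add: f_def poly_monom algebra_simps)
  ultimately show ?thesis
    using card_poly_roots_bound[of f] by simp
qed

lemma card_zeros_eq_q:
  fixes c d :: 'a
  assumes "c ^ (q + 1) = 1" and "d = c * d ^ q"
  shows "card {x. x ^ q + c * x + d = 0} = q"
proof -
  define L where "L = (\<lambda>x. - (x ^ q + c * x))"
  define T where "T = {e. e = c * e ^ q}"
  have zero_iff: "x ^ q + c * x + e = 0 \<longleftrightarrow> L x = e" for x e
    unfolding L_def by (rule neg_eq_iff_add_eq_0[symmetric])
  have "c \<noteq> 0"
    using assms(1) by auto
  moreover have "T = {e. c * e ^ q + (- 1) * e + 0 = 0}"
    by (auto simp: T_def)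
  ultimately have T_le: "card T \<le> q"
    using card_roots_le[of c "- 1" 0] by simp
  have fibre_le: "card {x. L x = e} \<le> q" for e
    using card_roots_le[of 1 c e] by (simp add: zero_iff)
  have "range L \<subseteq> T"
    using zero_imp_eq_mult_power[OF assms(1)] zero_iff unfolding T_def by blast
  then have sum_fibres: "(\<Sum>e\<in>T. card {x. L x = e}) = q * q"
    using sum.group[of UNIV T L "\<lambda>_. 1 :: nat"] CARD_eq by (simp add: power2_eq_square)
  \<comment> \<open>The termwise bound \<open>q\<close> is attained in total, hence in every term.\<close>
  moreover have "(\<Sum>e\<in>T. card {x. L x = e}) \<le> (\<Sum>e\<in>T. q)"
    by (rule sum_mono) (rule fibre_le)
  moreover have "(\<Sum>e\<in>T. q) \<le> q * q"
    using T_le by simp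
  ultimately have "(\<Sum>e\<in>T. card {x. L x = e}) = (\<Sum>e\<in>T. q)"
    by linarith
  then have "card {x. L x = d} = q"
    by (rule sum_mono_inv) (use assms(2) fibre_le in \<open>auto simp: T_def\<close>)
  then show ?thesis
    by (simp add: zero_iff)
qed

end

theorem lemma3p1:
  fixes p k q :: nat and c d :: "'a::{field,finite}"
  assumes "prime p" and "k \<ge> 1" and "q = p ^ k"
    and "CARD('a) = q ^ 2"
  shows "card {x :: 'a. x ^ q + c * x + d = 0} =
    (if c \<notin> mu (q + 1) then 1
     else if d = c * d ^ q then q
     else 0)"
proof -
  have "CARD('a) = p ^ (k * 2)"
    using assms(3,4) by (simp add: power_mult)
  then have char: "CHAR('a) = p"
    using CHAR_eq_of_CARD_prime_power assms(1) by blast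
  interpret additive_involutive_power q "TYPE('a)"
    by standard (use assms char freshmans_dream' in auto)
  have mu_iff: "c \<in> mu (q + 1) \<longleftrightarrow> c ^ (q + 1) = 1"
    by (auto simp: mu_def)
  consider "c ^ (q + 1) \<noteq> 1" | "c ^ (q + 1) = 1" "d = c * d ^ q"
    | "c ^ (q + 1) = 1" "d \<noteq> c * d ^ q"
    by blast
  then show ?thesis
  proof cases
    case 1
    then show ?thesis
      using card_zeros_eq_1 mu_iff by simp
  next
    case 2
    then show ?thesis
      using card_zeros_eq_q[OF 2] mu_iff by simp
  next
    case 3
    then have "{x. x ^ q + c * x + d = 0} = {}"
      using zero_imp_eq_mult_power by blast
    then show ?thesis
      using 3 mu_iff by simp
  qed
qed

end
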